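(* Let $a,b\in\mathbb{N}$ and let $S(a,b)=(s_i)_{i\in\mathbb{N}}$ with $s_i=ai+b$. (1) If $a$ and $b$ are both odd, then $T_1$ maps $S(a,b)$ to the subsequence (complete and in the original order) of all odd terms $s_i$ of $S(a,b)$, and $T_2$ maps $S(a,b)$ to the subsequence (complete and in the original order) of all even terms $s_i$ of $S(a,b)$. (2) If $a$ is odd and $b$ is even, then $T_1$ maps $S(a,b)$ to the subsequence (complete and in the original order) of all even terms $s_i$ of $S(a,b)$, and $T_2$ maps $S(a,b)$ to the subsequence (complete and in the original order) of all odd terms $s_i$ of $S(a,b)$.
   Context: $\mathbb{N}=\{0,1,2,\dots\}$. For $a,b\in\mathbb{N}$, $S(a,b)$ denotes the sequence $(ai+b)_{i\in\mathbb{N}}$. The operators $T_1,T_2$ are the index substitutions $T_1: i\mapsto 2j$ and $T_2: i\mapsto 2j+1$; they act on sequences by $T_1:S(a,b)\mapsto S(2a,b)=(2aj+b)_{j\in\mathbb{N}}$ and $T_2:S(a,b)\mapsto S(2a,b+a)=(2aj+a+b)_{j\in\mathbb{N}}$. *)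

theory Defs
  imports Main
begin

definition S :: "nat \<Rightarrow> nat \<Rightarrow> nat \<Rightarrow> nat" where
  "S a b = (\<lambda>i. a * i + b)"

definition T1 :: "(nat \<Rightarrow> 'a) \<Rightarrow> nat \<Rightarrow> 'a" where
  "T1 s = (\<lambda>j. s (2 * j))"

definition T2 :: "(nat \<Rightarrow> 'a) \<Rightarrow> nat \<Rightarrow> 'a" where
  "T2 s = (\<lambda>j. s (2 * j + 1))"

lemma T1_S: "T1 (S a b) = S (2 * a) b"
  by (simp add: T1_def S_def fun_eq_iff)

lemma T2_S: "T2 (S a b) = S (2 * a) (b + a)"
  by (simp add: T2_def S_def fun_eq_iff algebra_simps)

text \<open>
  \<open>t\<close> is the subsequence of all terms of \<open>s\<close> that satisfy \<open>P\<close>. Strict monotonicity of the index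
  map \<open>r\<close> keeps the original order, and the condition on its range says that exactly the terms
  satisfying \<open>P\<close> are selected, each index once. Terms are selected by index, so equal terms at
  different positions count separately. Since \<open>t\<close> is an infinite sequence, the predicate also
  entails that infinitely many terms of \<open>s\<close> satisfy \<open>P\<close>.
\<close>

definition is_subseq_of_all :: "('a \<Rightarrow> bool) \<Rightarrow> (nat \<Rightarrow> 'a) \<Rightarrow> (nat \<Rightarrow> 'a) \<Rightarrow> bool" where
  "is_subseq_of_all P s t \<longleftrightarrow>
     (\<exists>r :: nat \<Rightarrow> nat. strict_mono r \<and> range r = {i. P (s i)} \<and> t = s \<circ> r)"

end

theory Submission
  imports Defs
begin

text \<open>
  If \<open>a\<close> is odd, then \<open>a * i + b\<close> has the parity of \<open>i + b\<close>, so whether a term of \<open>S a b\<close> is even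
  or odd depends only on the parity of its index. The terms of one parity are therefore exactly
  those at the even indices, and the terms of the other parity exactly those at the odd indices.
  The index maps \<open>j \<mapsto> 2 * j\<close> and \<open>j \<mapsto> 2 * j + 1\<close> underlying \<open>T1\<close> and \<open>T2\<close> enumerate these two
  index sets increasingly, and the parity of \<open>b\<close> decides which parity of terms each one selects.
\<close>

lemma is_subseq_of_all_T1:
  assumes "\<And>i. P (s i) \<longleftrightarrow> even i"
  shows "is_subseq_of_all P s (T1 s)"
  unfolding is_subseq_of_all_def
proof (intro exI conjI)
  show "strict_mono (\<lambda>j::nat. 2 * j)"
    by (simp add: strict_mono_def)
  show "range (\<lambda>j. 2 * j) = {i. P (s i)}"
    by (auto simp: assms elim: evenE)
  show "T1 s = s \<circ> (\<lambda>j. 2 * j)"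
    by (simp add: T1_def comp_def)
qed

lemma is_subseq_of_all_T2:
  assumes "\<And>i. P (s i) \<longleftrightarrow> odd i"
  shows "is_subseq_of_all P s (T2 s)"
  unfolding is_subseq_of_all_def
proof (intro exI conjI)
  show "strict_mono (\<lambda>j::nat. 2 * j + 1)"
    by (simp add: strict_mono_def)
  show "range (\<lambda>j. 2 * j + 1) = {i. P (s i)}"
    by (auto simp: assms elim: oddE)
  show "T2 s = s \<circ> (\<lambda>j. 2 * j + 1)"
    by (simp add: T2_def comp_def)
qed

lemma even_S_iff:
  assumes "odd a"
  shows "even (S a b i) \<longleftrightarrow> (even i \<longleftrightarrow> even b)"
  using assms by (auto simp: S_def)

theorem proposition4p1:
  fixes a b :: nat
  shows "(odd a \<and> odd b \<longrightarrow>
            is_subseq_of_all odd (S a b) (T1 (S a b)) \<and>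
            is_subseq_of_all even (S a b) (T2 (S a b))) \<and>
         (odd a \<and> even b \<longrightarrow>
            is_subseq_of_all even (S a b) (T1 (S a b)) \<and>
            is_subseq_of_all odd (S a b) (T2 (S a b)))"
  by (intro conjI impI is_subseq_of_all_T1 is_subseq_of_all_T2) (auto simp: even_S_iff)

end
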